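(* Let $k\in\mathbb{K}(\mathbb{R}_+)$ be an admissible kernel and, for $\tau\in[0,\infty)$ and $t>0$, let $G_t(\tau)$ be the associated function defined in the context, where $\int_0^\infty e^{-\lambda t}G_t(\tau)\,dt$ exists for all $\lambda>0$. Then for every fixed $\tau\in[0,\infty)$ $$\lim_{t\to\infty}\left(\int_0^t G_s(\tau)\,ds\right)\left(\int_0^t k(s)\,ds\right)^{-1}=1,$$ equivalently, $\frac1t\int_0^t G_s(\tau)\,ds\sim \frac1t\int_0^t k(s)\,ds$ as $t\to\infty$. Moreover, the Cesàro mean $\frac1t\int_0^t G_s(\tau)\,ds$ is uniformly bounded in $\tau\in\mathbb{R}_+$, that is, for every $t>0$, $$\sup_{\tau\in[0,\infty)}\frac1t\int_0^t G_s(\tau)\,ds<\infty .$$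
   Context: $\mathbb{R}_+:=[0,\infty)$. For $k\in L^1_{\mathrm{loc}}(\mathbb{R}_+)$ non-negative, write $\mathcal{K}(\lambda):=\int_0^\infty e^{-\lambda t}k(t)\,dt$ for its Laplace transform. Admissible kernels: $\mathbb{K}(\mathbb{R}_+)$ is the set of all non-negative $k\in L^1_{\mathrm{loc}}(\mathbb{R}_+)$ such that $\int_0^\infty k(s)\,ds>0$, $\mathcal{K}(\lambda)$ exists (is finite) for all $\lambda>0$, $\mathcal{K}$ is a Stieltjes function (i.e. $\mathcal{K}(\lambda)=\frac{a}{\lambda}+b+\int_{(0,\infty)}\frac{1}{\lambda+t}\,d\sigma(t)$ with $a,b\ge 0$ and $\sigma$ a Borel measure on $(0,\infty)$ with $\int_{(0,\infty)}(1+t)^{-1}\,d\sigma(t)<\infty$; equivalently $\lambda\mapsto\lambda\mathcal{K}(\lambda)$ is a complete Bernstein function), $$\mathcal{K}(\lambda)\to\infty \text{ as }\lambda\to0+,\quad \mathcal{K}(\lambda)\to 0\text{ as }\lambda\to\infty,\quad \lambda\mathcal{K}(\lambda)\to0\text{ as }\lambda\to0+,\quad \lambda\mathcal{K}(\lambda)\to\infty\text{ as }\lambda\to\infty,$$ and, in addition, both of these conditions hold: (i) for some $s_0>0$, $\displaystyle\liminf_{\lambda\to0+}\frac{1}{\mathcal{K}(\lambda)}\int_0^{s_0/\lambda}k(t)\,dt>0$; (ii) $\displaystyle\left(\int_0^t k(s)\,ds\right)\left(\int_0^r k(s)\,ds\right)^{-1}\to 1$ as $t,r\to\infty$ with $t/r\to1$.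 The function $G_t(\tau)$: for each $\tau\ge0$ the function $\lambda\mapsto e^{-\tau\lambda\mathcal{K}(\lambda)}$ is completely monotone, and by Bernstein's theorem there is a unique probability measure $\nu_\tau$ on $[0,\infty)$ with $e^{-\tau\lambda\mathcal{K}(\lambda)}=\int_{[0,\infty)}e^{-\lambda s}\,d\nu_\tau(s)$ for all $\lambda>0$. Define $$G_t(\tau):=\int_{[0,t)}k(t-s)\,d\nu_\tau(s),\qquad t>0,\ \tau\ge0,$$ (as a function of $t$, defined for almost every $t>0$). Its Laplace transform in $t$ is $\int_0^\infty e^{-\lambda t}G_t(\tau)\,dt=\mathcal{K}(\lambda)e^{-\tau\lambda\mathcal{K}(\lambda)}$ for $\lambda>0$. *)

theory Defs
  imports "HOL-Probability.Probability" "HOL-Library.Landau_Symbols"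
begin

definition laplace :: "(real \<Rightarrow> real) \<Rightarrow> real \<Rightarrow> real" where
  "laplace f l = (LBINT t:{0..}. exp (- l * t) * f t)"

definition stieltjes :: "(real \<Rightarrow> real) \<Rightarrow> bool" where
  "stieltjes F \<longleftrightarrow> (\<exists>a b (\<sigma> :: real measure). a \<ge> 0 \<and> b \<ge> 0 \<and>
     sets \<sigma> = sets (restrict_space borel {0<..}) \<and>
     integrable \<sigma> (\<lambda>t. 1 / (1 + t)) \<and>
     (\<forall>l>0. F l = a / l + b + (\<integral>t. 1 / (l + t) \<partial>\<sigma>)))"

text \<open>
  Kernels are Borel representatives of elements of the space of locally integrable functions
  on the closed half-line; values on the negative half-line play no role. The total
  mass may be infinite, so its positivity is stated with the nonnegative integral. In the last
  clause the limit is along pairs tending to infinity whose quotient tends to one.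
\<close>

definition admissible_kernel :: "(real \<Rightarrow> real) \<Rightarrow> bool" where
  "admissible_kernel k \<longleftrightarrow>
     (\<forall>T>0. set_integrable lborel {0..T} k) \<and>
     (AE t in lborel. t \<ge> 0 \<longrightarrow> k t \<ge> 0) \<and>
     (\<integral>\<^sup>+ t\<in>{0..}. ennreal (k t) \<partial>lborel) > 0 \<and>
     (\<forall>l>0. set_integrable lborel {0..} (\<lambda>t. exp (- l * t) * k t)) \<and>
     stieltjes (laplace k) \<and>
     filterlim (laplace k) at_top (at_right 0) \<and>
     (laplace k \<longlongrightarrow> 0) at_top \<and>
     ((\<lambda>l. l * laplace k l) \<longlongrightarrow> 0) (at_right 0) \<and>
     filterlim (\<lambda>l. l * laplace k l) at_top at_top \<and>
     (\<exists>s0>0. Liminf (at_right 0)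
        (\<lambda>l. ereal (1 / laplace k l * (LBINT t:{0..s0 / l}. k t))) > 0) \<and>
     ((\<lambda>(t, r). (LBINT s:{0..t}. k s) * inverse (LBINT s:{0..r}. k s)) \<longlongrightarrow> 1)
        (inf (at_top \<times>\<^sub>F at_top) (filtercomap (\<lambda>(t, r). t / r) (nhds 1)))"

text \<open>
  For an admissible kernel and nonnegative \<open>\<tau>\<close> the description below has exactly one solution,
  by Bernstein's theorem.
\<close>

definition subordination_measure :: "(real \<Rightarrow> real) \<Rightarrow> real \<Rightarrow> real measure" where
  "subordination_measure k \<tau> = (THE \<nu>. prob_space \<nu> \<and>
     sets \<nu> = sets (restrict_space borel {0..}) \<and>
     (\<forall>l>0. exp (- \<tau> * l * laplace k l) = (\<integral>s. exp (- l * s) \<partial>\<nu>)))"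

definition G :: "(real \<Rightarrow> real) \<Rightarrow> real \<Rightarrow> real \<Rightarrow> real" where
  "G k t \<tau> = set_lebesgue_integral (subordination_measure k \<tau>) {0..<t} (\<lambda>s. k (t - s))"

end

theory Submission
  imports Defs "HOL-Real_Asymp.Real_Asymp"
begin

text \<open>
  No Tauberian theorem is needed. By Tonelli's theorem, the primitive of \<open>G\<close> at time \<open>t\<close> is the
  \<open>\<nu>\<^sub>\<tau>\<close>-integral of \<open>s \<mapsto> \<kappa> (t - s)\<close>, where \<open>\<kappa>\<close> is the primitive of \<open>k\<close>. As \<open>\<kappa>\<close> is nondecreasing,
  \<open>\<kappa> (t - s) / \<kappa> t\<close> is at most one, which gives the uniform bound; by the last admissibility clause
  it tends to one for each \<open>s\<close>, and dominated convergence gives the limit.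

  What remains is to show that \<open>\<nu>\<^sub>\<tau>\<close> exists and is unique. The limits of \<open>\<K>\<close> kill the constants
  \<open>a\<close> and \<open>b\<close> of the Stieltjes representation, so \<open>\<lambda> \<K>(\<lambda>)\<close> is the integral of \<open>\<lambda> / (\<lambda> + t)\<close> against
  \<open>\<sigma>\<close>. Weighting \<open>\<sigma>\<close> by \<open>n / (n + t)\<close> makes it finite and turns \<open>exp (- \<tau> \<lambda> \<K>(\<lambda>))\<close> into the
  transform of a compound Poisson law whose jumps are mixtures of exponentials; then \<open>n\<close> tends to
  infinity. Uniqueness is Weierstrass approximation in the variable \<open>exp (- s)\<close>.
\<close>

section \<open>Laplace transforms of probability measures on the half-line\<close>

text \<open>The law lives on the whole Borel line, with the half-line imposed almost everywhere, so
  that the theory of tightness, weak convergence and distribution functions of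
  \<open>real_distribution\<close> applies. Restriction to \<open>{0..}\<close> is postponed to
  \<open>subordination_measure_eq\<close>.\<close>

definition laplace_dist :: "real measure \<Rightarrow> (real \<Rightarrow> real) \<Rightarrow> bool" where
  "laplace_dist \<mu> \<phi> \<longleftrightarrow> real_distribution \<mu> \<and> (AE x in \<mu>. 0 \<le> x) \<and>
     (\<forall>l>0. (\<integral>x. exp (- l * x) \<partial>\<mu>) = \<phi> l)"

lemma laplace_dist_distr:
  fixes X :: "'a \<Rightarrow> real"
  assumes "prob_space M" and [measurable]: "X \<in> borel_measurable M" and "AE x in M. 0 \<le> X x"
  shows "laplace_dist (distr M borel X) (\<lambda>l. \<integral>x. exp (- l * X x) \<partial>M)"
proof -
  interpret prob_space M by fact
  show ?thesis
    unfolding laplace_dist_def using assms(3)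
    by (auto simp: AE_distr_iff integral_distr)
qed

lemma laplace_dist_cong:
  "laplace_dist \<mu> \<phi> \<Longrightarrow> (\<And>l. l > 0 \<Longrightarrow> \<phi> l = \<psi> l) \<Longrightarrow> laplace_dist \<mu> \<psi>"
  by (auto simp: laplace_dist_def)

lemma integrable_exp_laplace_dist:
  assumes "laplace_dist \<mu> \<phi>" "l \<ge> 0"
  shows "integrable \<mu> (\<lambda>x. exp (- l * x))"
proof -
  interpret real_distribution \<mu> using assms by (simp add: laplace_dist_def)
  have "AE x in \<mu>. norm (exp (- l * x)) \<le> 1"
    using assms by (auto simp: laplace_dist_def elim!: eventually_mono)
  thus ?thesis by (rule integrable_const_bound) auto
qed

section \<open>Products, powers and mixtures of transforms\<close>

lemma laplace_dist_one: "laplace_dist (return borel 0) (\<lambda>_. 1)"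
  unfolding laplace_dist_def real_distribution_def real_distribution_axioms_def
  by (auto simp: prob_space_return AE_return integral_return)

text \<open>The witness is the law of a sum of independent variables with laws \<mu> and
  \<nu>.\<close>

lemma laplace_dist_mult:
  assumes "laplace_dist \<mu> \<phi>" "laplace_dist \<nu> \<psi>"
  shows "\<exists>\<xi>. laplace_dist \<xi> (\<lambda>l. \<phi> l * \<psi> l)"
proof -
  interpret A: real_distribution \<mu> using assms by (simp add: laplace_dist_def)
  interpret B: real_distribution \<nu> using assms by (simp add: laplace_dist_def)
  interpret P: pair_prob_space \<mu> \<nu> ..
  have nn: "AE z in \<mu> \<Otimes>\<^sub>M \<nu>. 0 \<le> fst z + snd z"
  proof (rule P.AE_pair_measure)
    show "{z \<in> space (\<mu> \<Otimes>\<^sub>M \<nu>). 0 \<le> fst z + snd z} \<in> sets (\<mu> \<Otimes>\<^sub>M \<nu>)" by measurable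
    show "AE x in \<mu>. AE y in \<nu>. 0 \<le> fst (x, y) + snd (x, y)"
      using assms by (auto simp: laplace_dist_def elim!: eventually_mono)
  qed
  have "laplace_dist (distr (\<mu> \<Otimes>\<^sub>M \<nu>) borel (\<lambda>z. fst z + snd z))
      (\<lambda>l. \<integral>z. exp (- l * (fst z + snd z)) \<partial>(\<mu> \<Otimes>\<^sub>M \<nu>))"
    using P.prob_space_axioms nn by (intro laplace_dist_distr) auto
  moreover have "(\<integral>z. exp (- l * (fst z + snd z)) \<partial>(\<mu> \<Otimes>\<^sub>M \<nu>)) = \<phi> l * \<psi> l" if "l > 0" for l
  proof -
    have "AE z in \<mu> \<Otimes>\<^sub>M \<nu>. norm (exp (- l * (fst z + snd z))) \<le> 1"
      using nn by eventually_elim (use that in auto)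
    hence "integrable (\<mu> \<Otimes>\<^sub>M \<nu>) (\<lambda>z. exp (- l * (fst z + snd z)))"
      by (rule P.integrable_const_bound) auto
    from P.integral_fst'[OF this]
    have "(\<integral>z. exp (- l * (fst z + snd z)) \<partial>(\<mu> \<Otimes>\<^sub>M \<nu>)) =
        (\<integral>x. (\<integral>y. exp (- l * x) * exp (- l * y) \<partial>\<nu>) \<partial>\<mu>)"
      by (simp add: exp_add[symmetric] algebra_simps)
    thus ?thesis using assms that by (simp add: laplace_dist_def)
  qed
  ultimately show ?thesis by (blast intro: laplace_dist_cong)
qed

lemma laplace_dist_power:
  assumes "laplace_dist \<mu> \<phi>"
  shows "\<exists>\<xi>. laplace_dist \<xi> (\<lambda>l. \<phi> l ^ n)"
proof (induction n)
  case 0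
  then show ?case using laplace_dist_one by auto
next
  case (Suc n)
  then show ?case using laplace_dist_mult[OF assms] by auto
qed

text \<open>The witness is the law of \<open>B * X\<close> with \<open>B\<close> Bernoulli of
  parameter \<open>p\<close> and independent of \<open>X\<close>: mass \<open>1 - p\<close> is moved
  to the origin.\<close>

lemma laplace_dist_mix_one:
  assumes "laplace_dist \<mu> \<phi>" "0 \<le> p" "p \<le> 1"
  shows "\<exists>\<xi>. laplace_dist \<xi> (\<lambda>l. 1 - p + p * \<phi> l)"
proof -
  interpret A: real_distribution \<mu> using assms by (simp add: laplace_dist_def)
  interpret P: pair_prob_space "measure_pmf (bernoulli_pmf p)" \<mu> ..
  let ?M = "measure_pmf (bernoulli_pmf p) \<Otimes>\<^sub>M \<mu>"
  let ?X = "\<lambda>z. if fst z then snd z else (0::real)"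
  have nn: "AE z in ?M. 0 \<le> ?X z"
  proof (rule P.AE_pair_measure)
    show "{z \<in> space ?M. 0 \<le> ?X z} \<in> sets ?M" by measurable
    show "AE x in measure_pmf (bernoulli_pmf p). AE y in \<mu>. 0 \<le> ?X (x, y)"
      using assms by (auto simp: laplace_dist_def elim!: eventually_mono)
  qed
  have "laplace_dist (distr ?M borel ?X) (\<lambda>l. \<integral>z. exp (- l * ?X z) \<partial>?M)"
    using P.prob_space_axioms nn by (intro laplace_dist_distr) auto
  moreover have "(\<integral>z. exp (- l * ?X z) \<partial>?M) = 1 - p + p * \<phi> l" if "l > 0" for l
  proof -
    have "AE z in ?M. norm (exp (- l * ?X z)) \<le> 1"
      using nn by eventually_elim (use that in auto)
    hence "integrable ?M (\<lambda>z. exp (- l * ?X z))"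
      by (rule P.integrable_const_bound) auto
    from P.integral_fst'[OF this]
    have "(\<integral>z. exp (- l * ?X z) \<partial>?M) =
        (\<integral>b. (\<integral>y. exp (- l * ?X (b, y)) \<partial>\<mu>) \<partial>measure_pmf (bernoulli_pmf p))"
      by simp
    also have "\<dots> = p * (\<integral>y. exp (- l * y) \<partial>\<mu>) + (1 - p)"
      using assms A.prob_space by simp
    finally show ?thesis using assms that by (simp add: laplace_dist_def)
  qed
  ultimately show ?thesis by (blast intro: laplace_dist_cong)
qed

section \<open>Limits of transforms\<close>

lemma laplace_dist_tendsto_1:
  assumes "laplace_dist \<mu> \<phi>"
  shows "(\<phi> \<longlongrightarrow> 1) (at_right 0)"
proof -
  interpret real_distribution \<mu> using assms by (simp add: laplace_dist_def)
  have "((\<lambda>t. \<integral>x. exp (- inverse t * x) \<partial>\<mu>) \<longlongrightarrow> (\<integral>x. 1 \<partial>\<mu>)) at_top"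
  proof (rule integral_dominated_convergence_at_top[where w = "\<lambda>_. 1"])
    have "AE x in \<mu>. norm (exp (- inverse i * x)) \<le> 1" if "i > 0" for i :: real
      using assms that by (auto simp: laplace_dist_def elim!: eventually_mono)
    thus "\<forall>\<^sub>F i in at_top. AE x in \<mu>. norm (exp (- inverse i * x)) \<le> 1"
      by (rule eventually_mono[OF eventually_gt_at_top[of "0::real"]])
    have "((\<lambda>i. exp (- inverse i * x)) \<longlongrightarrow> exp (- 0 * x)) at_top" for x :: real
      by (intro tendsto_intros tendsto_inverse_0_at_top filterlim_ident)
    thus "AE x in \<mu>. ((\<lambda>i. exp (- inverse i * x)) \<longlongrightarrow> 1) at_top" by simp
  qed auto
  moreover have "\<forall>\<^sub>F t in at_top. (\<integral>x. exp (- inverse t * x) \<partial>\<mu>) = \<phi> (inverse t)"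
    by (rule eventually_mono[OF eventually_gt_at_top[of 0]]) (use assms in \<open>auto simp: laplace_dist_def\<close>)
  ultimately have "((\<lambda>t. \<phi> (inverse t)) \<longlongrightarrow> (\<integral>x. 1 \<partial>\<mu>)) at_top"
    by (rule Lim_transform_eventually)
  thus ?thesis using prob_space by (simp add: filterlim_at_right_to_top)
qed

text \<open>Markov's inequality turns the convergence \<open>\<phi> \<longlongrightarrow> 1\<close> at \<open>0\<close> into tightness.\<close>

lemma laplace_dist_limit:
  fixes \<mu> :: "nat \<Rightarrow> real measure"
  assumes \<mu>: "\<And>n. laplace_dist (\<mu> n) (\<Phi> n)"
    and lim: "\<And>l. l > 0 \<Longrightarrow> (\<lambda>n. \<Phi> n l) \<longlonglongrightarrow> \<phi> l"
    and \<phi>: "(\<phi> \<longlongrightarrow> 1) (at_right 0)"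
  shows "\<exists>\<xi>. laplace_dist \<xi> \<phi>"
proof -
  interpret real_distribution "\<mu> n" for n using \<mu> by (simp add: laplace_dist_def)
  have nn: "AE x in \<mu> n. 0 \<le> x" for n using \<mu> by (simp add: laplace_dist_def)
  have "tight \<mu>"
    unfolding tight_def
  proof safe
    fix \<epsilon> :: real assume "\<epsilon> > 0"
    \<comment> \<open>\<open>c\<close> is the value of \<open>1 - exp (- l * x)\<close> at
      \<open>x = 1 / l\<close>; beyond that point the function is at least \<open>c\<close>, which
      is what Markov's inequality uses.\<close>
    define c where "c = 1 - exp (-1::real)"
    have "c > 0" by (simp add: c_def)
    have "\<forall>\<^sub>F l in at_right 0. \<phi> l > 1 - c * \<epsilon> \<and> l > 0"
      using \<phi> \<open>c > 0\<close> \<open>\<epsilon> > 0\<close>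
      by (intro eventually_conj order_tendstoD(1)[OF \<phi>]) (auto simp: eventually_at_right_less)
    then obtain l where l: "\<phi> l > 1 - c * \<epsilon>" "l > 0"
      by (auto dest!: eventually_happens)
    have "\<forall>\<^sub>F n in sequentially. \<Phi> n l > 1 - c * \<epsilon>"
      using lim[OF l(2)] l(1) by (rule order_tendstoD)
    then obtain N where N: "\<And>n. n \<ge> N \<Longrightarrow> \<Phi> n l > 1 - c * \<epsilon>"
      by (auto simp: eventually_sequentially)
    \<comment> \<open>Tightness asks for intervals open on the left, so a negative left endpoint is
      needed to keep a possible atom at 0.\<close>
    have meas: "measure (\<mu> n) {-1<..b} = cdf (\<mu> n) b" for n b
    proof -
      have "measure (\<mu> n) {-1<..b} = measure (\<mu> n) {..b}"
        by (intro measure_eq_AE) (use nn[of n] in \<open>auto elim!: eventually_mono\<close>)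
      thus ?thesis by (simp add: cdf_def)
    qed
    have tail: "cdf (\<mu> n) (1 / l) > 1 - \<epsilon>" if "n \<ge> N" for n
    proof -
      have "c * (1 - cdf (\<mu> n) (1 / l)) = (\<integral>x. c * indicator {1/l<..} x \<partial>\<mu> n)"
        using prob_compl[of "{..1/l}" n]
        by (simp add: cdf_def Compl_eq_Diff_UNIV[symmetric] Compl_atMost)
      also have "\<dots> \<le> (\<integral>x. 1 - exp (- l * x) \<partial>\<mu> n)"
      proof (rule integral_mono_AE)
        show "integrable (\<mu> n) (\<lambda>x. 1 - exp (- l * x))"
          using integrable_exp_laplace_dist[OF \<mu>, of l n] l by auto
        show "AE x in \<mu> n. c * indicator {1/l<..} x \<le> 1 - exp (- l * x)"
          using nn[of n]
        proof eventually_elim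
          case (elim x)
          thus ?case using l by (auto simp: c_def indicator_def field_simps)
        qed
        show "integrable (\<mu> n) (\<lambda>x. c * indicator {1/l<..} x)"
          by (intro integrable_mult_right) (auto simp: integrable_indicator_iff less_top[symmetric])
      qed
      also have "\<dots> = 1 - \<Phi> n l"
        using integrable_exp_laplace_dist[OF \<mu>, of l n] \<mu>[of n] l prob_space[of n]
        by (simp add: laplace_dist_def)
      also have "\<dots> < c * \<epsilon>" using N[OF that] by simp
      finally show ?thesis using \<open>c > 0\<close> by simp
    qed
    \<comment> \<open>The uniform tail estimate covers only \<open>n \<ge> N\<close>; the finitely
      many remaining laws are handled one by one.\<close>
    have "\<forall>\<^sub>F b in at_top. \<forall>n\<in>{..<N}. cdf (\<mu> n) b > 1 - \<epsilon>"
      using \<open>\<epsilon> > 0\<close> by (intro eventually_ball_finite ballI order_tendstoD(1)[OF cdf_lim_at_top_prob]) auto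
    hence "\<forall>\<^sub>F b in at_top. (\<forall>n\<in>{..<N}. cdf (\<mu> n) b > 1 - \<epsilon>) \<and> b > 1 / l"
      using eventually_gt_at_top by (rule eventually_conj)
    then obtain b where b: "\<And>n. n < N \<Longrightarrow> cdf (\<mu> n) b > 1 - \<epsilon>" "b > 1 / l"
      by (auto dest!: eventually_happens)
    have "cdf (\<mu> n) b > 1 - \<epsilon>" for n
    proof (cases "n < N")
      case False
      thus ?thesis using tail[of n] cdf_nondecreasing[of "1/l" b n] b(2) by linarith
    qed (use b in auto)
    moreover have "-1 < b" using b(2) l(2) by (smt (verit) divide_nonneg_pos)
    ultimately show "\<exists>a b. a < b \<and> (\<forall>n. 1 - \<epsilon> < measure (\<mu> n) {a<..b})"
      by (intro exI[of _ "-1"] exI[of _ b]) (auto simp: meas)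
  qed (rule real_distribution_axioms)
  from tight_imp_convergent_subsubsequence[OF this strict_mono_id]
  obtain r M where r: "strict_mono r" "real_distribution M" "weak_conv_m (\<mu> \<circ> id \<circ> r) M"
    by blast
  interpret M: real_distribution M by fact
  have conv: "(\<lambda>n. integral\<^sup>L (\<mu> (r n)) f) \<longlonglongrightarrow> integral\<^sup>L M f"
    if "\<And>x. isCont f x" "\<And>x. norm (f x) \<le> 1" for f :: "real \<Rightarrow> real"
    using weak_conv_imp_integral_bdd_continuous_conv[OF _ r(2) r(3) that] real_distribution_axioms
    by simp
  have nnM: "AE x in M. 0 \<le> x"
  proof -
    \<comment> \<open>A bounded continuous function that vanishes exactly on the half-line, so a
      zero integral against the limit law forces its concentration there.\<close>
    define f where "f = (\<lambda>x::real. min 1 (max 0 (- x)))"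
    have f: "(\<lambda>n. integral\<^sup>L (\<mu> (r n)) f) \<longlonglongrightarrow> integral\<^sup>L M f"
      by (rule conv) (auto simp: f_def intro!: continuous_intros)
    have "integral\<^sup>L (\<mu> n) f = 0" for n
      by (intro integral_eq_zero_AE) (use nn[of n] in \<open>auto simp: f_def elim!: eventually_mono\<close>)
    with f have "integral\<^sup>L M f = 0" by (simp add: LIMSEQ_const_iff)
    moreover have [measurable]: "f \<in> borel_measurable borel"
      by (intro borel_measurable_continuous_onI) (auto simp: f_def intro!: continuous_intros)
    have "integrable M f"
      by (rule M.integrable_const_bound[where B = 1]) (auto simp: f_def)
    ultimately have "AE x in M. f x = 0"
      by (subst (asm) integral_nonneg_eq_0_iff_AE) (auto simp: f_def)
    thus ?thesis by eventually_elim (auto simp: f_def min_def max_def split: if_splits)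
  qed
  have "(\<integral>x. exp (- l * x) \<partial>M) = \<phi> l" if "l > 0" for l
  proof -
    \<comment> \<open>Cutting at 0 makes the exponential bounded on the whole line, hence an
      admissible test function, without changing its integrals.\<close>
    define f where "f = (\<lambda>x::real. exp (- l * max 0 x))"
    have f: "(\<lambda>n. integral\<^sup>L (\<mu> (r n)) f) \<longlonglongrightarrow> integral\<^sup>L M f"
      by (rule conv) (use that in \<open>auto simp: f_def intro!: continuous_intros\<close>)
    have [measurable]: "f \<in> borel_measurable borel"
      by (intro borel_measurable_continuous_onI) (auto simp: f_def intro!: continuous_intros)
    have "integral\<^sup>L (\<mu> n) f = (\<integral>x. exp (- l * x) \<partial>\<mu> n)" for n
      by (intro integral_cong_AE) (auto simp: f_def max_absorb2 intro!: eventually_mono[OF nn[of n]])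
    hence "integral\<^sup>L (\<mu> n) f = \<Phi> n l" for n using \<mu>[of n] that by (simp add: laplace_dist_def)
    moreover have "integral\<^sup>L M f = (\<integral>x. exp (- l * x) \<partial>M)"
      by (intro integral_cong_AE) (auto simp: f_def max_absorb2 intro!: eventually_mono[OF nnM])
    moreover have "(\<lambda>n. \<Phi> (r n) l) \<longlonglongrightarrow> \<phi> l"
      using LIMSEQ_subseq_LIMSEQ[OF lim[OF that] r(1)] by (simp add: o_def)
    ultimately show ?thesis using f by (auto intro: LIMSEQ_unique)
  qed
  with nnM r(2) have "laplace_dist M \<phi>" by (simp add: laplace_dist_def)
  thus ?thesis ..
qed

text \<open>Poisson limit: the \<open>n\<close>-th power of
  \<open>1 - (c / n) * (1 - \<phi> l)\<close> is the transform of a sum of \<open>n\<close>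
  independent rarely nonzero jumps, and it tends to the exponential.\<close>

lemma laplace_dist_compound_poisson:
  assumes "laplace_dist \<mu> \<phi>" "c \<ge> 0"
  shows "\<exists>\<xi>. laplace_dist \<xi> (\<lambda>l. exp (- c * (1 - \<phi> l)))"
proof -
  \<comment> \<open>Shifting the index by \<open>N\<close> keeps \<open>c / (n + N)\<close> a
    probability from the first term on.\<close>
  obtain N :: nat where "c < real N" using reals_Archimedean2 by blast
  with assms(2) have N: "c \<le> real N" "N > 0" by (auto intro: gr0I)
  have "\<exists>\<xi>. laplace_dist \<xi> (\<lambda>l. (1 - c / real (n + N) + c / real (n + N) * \<phi> l) ^ (n + N))" for n
  proof -
    have "c / real (n + N) \<le> 1" using N by (simp add: divide_simps)
    with assms(2) laplace_dist_mix_one[OF assms(1), of "c / real (n + N)"]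
    obtain \<xi> where "laplace_dist \<xi> (\<lambda>l. 1 - c / real (n + N) + c / real (n + N) * \<phi> l)"
      by auto
    thus ?thesis by (rule laplace_dist_power)
  qed
  then obtain \<mu>' where \<mu>': "\<And>n. laplace_dist (\<mu>' n)
      (\<lambda>l. (1 - c / real (n + N) + c / real (n + N) * \<phi> l) ^ (n + N))" by metis
  show ?thesis
  proof (rule laplace_dist_limit[OF \<mu>'])
    fix l :: real
    have "(\<lambda>n. (1 + (- c * (1 - \<phi> l)) / real n) ^ n) \<longlonglongrightarrow> exp (- c * (1 - \<phi> l))"
      by (rule tendsto_exp_limit_sequentially)
    hence "(\<lambda>n. (1 + (- c * (1 - \<phi> l)) / real (n + N)) ^ (n + N)) \<longlonglongrightarrow> exp (- c * (1 - \<phi> l))"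
      by (rule LIMSEQ_ignore_initial_segment)
    thus "(\<lambda>n. (1 - c / real (n + N) + c / real (n + N) * \<phi> l) ^ (n + N)) \<longlonglongrightarrow> exp (- c * (1 - \<phi> l))"
      by (simp add: right_diff_distrib diff_divide_distrib add_diff_eq diff_add_eq)
  next
    have "((\<lambda>l. exp (- c * (1 - \<phi> l))) \<longlongrightarrow> exp (- c * (1 - 1))) (at_right 0)"
      by (intro tendsto_intros laplace_dist_tendsto_1[OF assms(1)])
    thus "((\<lambda>l. exp (- c * (1 - \<phi> l))) \<longlongrightarrow> 1) (at_right 0)" by simp
  qed
qed

text \<open>Transforms at the positive integers are moments of \<open>exp (- x)\<close>. They
  determine the integrals of continuous functions of \<open>exp (- x)\<close>, in particular of the
  ramps \<open>cts_step\<close>, and these squeeze the distribution functions.\<close>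

lemma laplace_dist_unique:
  assumes "laplace_dist \<mu> \<phi>" "laplace_dist \<nu> \<phi>"
  shows "\<mu> = \<nu>"
proof -
  interpret A: real_distribution \<mu> using assms by (simp add: laplace_dist_def)
  interpret B: real_distribution \<nu> using assms by (simp add: laplace_dist_def)
  \<comment> \<open>The zeroth moment is the total mass; it is treated apart because \<phi> is
    prescribed only for positive arguments.\<close>
  have pow: "(\<integral>x. exp (- x) ^ i \<partial>\<mu>) = (\<integral>x. exp (- x) ^ i \<partial>\<nu>)" for i :: nat
  proof (cases "i = 0")
    case True
    thus ?thesis using A.prob_space B.prob_space by simp
  next
    case False
    thus ?thesis using assms by (simp add: laplace_dist_def exp_of_nat_mult[symmetric])
  qed
  have int: "integrable \<xi> (\<lambda>x. exp (- x) ^ i)" if "laplace_dist \<xi> \<phi>" for i :: nat and \<xi>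
    using integrable_exp_laplace_dist[OF that, of "real i"] by (simp add: exp_of_nat_mult[symmetric])
  have eq: "(\<integral>x. f x \<partial>\<mu>) = (\<integral>x. f x \<partial>\<nu>)"
    if f: "\<And>x. f x = g (exp (- x))" "continuous_on {0..1} g"
      and [measurable]: "f \<in> borel_measurable borel" for f g :: "real \<Rightarrow> real"
  proof -
    have "\<bar>(\<integral>x. f x \<partial>\<mu>) - (\<integral>x. f x \<partial>\<nu>)\<bar> \<le> 0 + e" if "e > 0" for e
    proof -
      obtain p where p: "real_polynomial_function p" "\<And>x. x \<in> {0..1} \<Longrightarrow> \<bar>g x - p x\<bar> < e / 2"
        using Stone_Weierstrass_real_polynomial_function[OF _ f(2), of "e / 2"] \<open>e > 0\<close> by auto
      obtain a n where a: "p = (\<lambda>x. \<Sum>i\<le>n. a i * x ^ i)"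
        using p(1) by (auto simp: real_polynomial_function_iff_sum)
      have approx: "\<bar>(\<integral>x. f x \<partial>\<xi>) - (\<Sum>i\<le>n. a i * (\<integral>x. exp (- x) ^ i \<partial>\<xi>))\<bar> \<le> e / 2"
        if \<xi>: "laplace_dist \<xi> \<phi>" for \<xi>
      proof -
        interpret real_distribution \<xi> using \<xi> by (simp add: laplace_dist_def)
        have ip: "integrable \<xi> (\<lambda>x. p (exp (- x)))"
          using int[OF \<xi>] by (auto simp: a)
        have bd: "AE x in \<xi>. \<bar>f x - p (exp (- x))\<bar> \<le> e / 2"
          using \<xi> p(2) by (auto simp: laplace_dist_def f(1) less_imp_le elim!: eventually_mono)
        have id: "integrable \<xi> (\<lambda>x. f x - p (exp (- x)))"
          using bd by (intro integrable_const_bound[where B = "e / 2"]) (auto simp: a)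
        have if': "integrable \<xi> f"
          using Bochner_Integration.integrable_add[OF id ip] by simp
        have "(\<Sum>i\<le>n. a i * (\<integral>x. exp (- x) ^ i \<partial>\<xi>)) = (\<integral>x. p (exp (- x)) \<partial>\<xi>)"
          using int[OF \<xi>] by (simp add: a)
        hence "\<bar>(\<integral>x. f x \<partial>\<xi>) - (\<Sum>i\<le>n. a i * (\<integral>x. exp (- x) ^ i \<partial>\<xi>))\<bar> =
            \<bar>\<integral>x. f x - p (exp (- x)) \<partial>\<xi>\<bar>"
          using if' ip by simp
        also have "\<dots> \<le> (\<integral>x. \<bar>f x - p (exp (- x))\<bar> \<partial>\<xi>)" by (rule integral_abs_bound)
        also have "\<dots> \<le> (\<integral>x. e / 2 \<partial>\<xi>)"
          using bd id by (intro integral_mono_AE) auto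
        finally show ?thesis using prob_space by simp
      qed
      from approx[OF assms(1)] approx[OF assms(2)] show ?thesis unfolding pow by linarith
    qed
    hence "\<bar>(\<integral>x. f x \<partial>\<mu>) - (\<integral>x. f x \<partial>\<nu>)\<bar> \<le> 0" by (rule field_le_epsilon)
    thus ?thesis by simp
  qed
  have step: "(\<integral>x. cts_step a b x \<partial>\<mu>) = (\<integral>x. cts_step a b x \<partial>\<nu>)" if "a < b" for a b
  proof (rule eq)
    \<comment> \<open>The ramp in the variable \<open>u = exp (- x)\<close>. The region
      \<open>u \<le> exp (- b)\<close> corresponds to \<open>x \<ge> b\<close>, where the ramp is 0,
      so the logarithm never comes near its singularity.\<close>
    define g where "g = (\<lambda>u. if u \<le> exp (- b) then 0 else cts_step a b (- ln u))"
    show "cts_step a b x = g (exp (- x))" for x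
      using that by (auto simp: g_def cts_step_def)
    have "continuous_on {exp (-b)..} (\<lambda>u. cts_step a b (- ln u))"
      using cts_step_uniformly_continuous[OF that, THEN uniformly_continuous_imp_continuous]
      by (rule continuous_on_compose2) (auto intro!: continuous_intros simp: less_le_trans[OF exp_gt_zero])
    hence "continuous_on ({..exp (-b)} \<union> {exp (-b)..}) g"
      unfolding g_def
      by (intro continuous_on_If) (use that in \<open>auto simp: cts_step_def\<close>)
    thus "continuous_on {0..1} g" by (rule continuous_on_subset) auto
    show "cts_step a b \<in> borel_measurable borel"
      unfolding cts_step_def by measurable
  qed
  \<comment> \<open>The ramp from \<open>x\<close> to \<open>y\<close> lies between the indicators
    of \<open>{..x}\<close> and \<open>{..y}\<close>; then \<open>y\<close> decreases to
    \<open>x\<close> by right continuity. Used in both directions.\<close>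
  have le: "cdf \<xi> x \<le> cdf \<xi>' x"
    if "real_distribution \<xi>" "real_distribution \<xi>'"
      "\<And>a b. a < b \<Longrightarrow> integral\<^sup>L \<xi> (cts_step a b) = integral\<^sup>L \<xi>' (cts_step a b)" for \<xi> \<xi>' x
  proof (rule tendsto_lowerbound)
    show "(cdf \<xi>' \<longlongrightarrow> cdf \<xi>' x) (at_right x)"
      using finite_borel_measure.cdf_is_right_cont[OF real_distribution.finite_borel_measure_M[OF that(2)]]
      by (simp add: continuous_within)
    show "\<forall>\<^sub>F y in at_right x. cdf \<xi> x \<le> cdf \<xi>' y"
      using eventually_at_right_less[of x]
    proof eventually_elim
      case (elim y)
      show ?case
        using real_distribution.cdf_cts_step(1)[OF that(1) elim] that(3)[OF elim]
          real_distribution.cdf_cts_step(2)[OF that(2) elim] by simp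
    qed
  qed simp
  have "cdf \<mu> = cdf \<nu>"
    using le[of \<mu> \<nu>] le[of \<nu> \<mu>] step A.real_distribution_axioms B.real_distribution_axioms
    by (intro ext antisym) auto
  with A.real_distribution_axioms B.real_distribution_axioms show ?thesis by (rule cdf_unique)
qed

section \<open>The subordinator of a Stieltjes function\<close>

text \<open>Multiplying the density of rate 1 by \<open>exp (- c * y)\<close> gives
  \<open>1 / (1 + c)\<close> times the density of rate \<open>1 + c\<close>, which has mass
  one.\<close>

lemma laplace_exponential:
  assumes "c \<ge> 0"
  shows "(\<integral>y. exp (- c * y) \<partial>density lborel (exponential_density 1)) = 1 / (1 + c)"
proof -
  have tot: "(\<integral>y. exponential_density a y \<partial>lborel) = 1" if "a > 0" for a
  proof -
    interpret prob_space "density lborel (exponential_density a)"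
      by (rule prob_space_exponential_density) fact
    have "(\<integral>y. 1 \<partial>density lborel (exponential_density a)) = (\<integral>y. exponential_density a y *\<^sub>R (1::real) \<partial>lborel)"
      by (rule integral_density) (use that in \<open>auto simp: exponential_density_nonneg\<close>)
    thus ?thesis using prob_space by simp
  qed
  have "(\<integral>y. exp (- c * y) \<partial>density lborel (exponential_density 1)) =
      (\<integral>y. exponential_density 1 y *\<^sub>R exp (- c * y) \<partial>lborel)"
    by (rule integral_density) (auto simp: exponential_density_nonneg)
  also have "\<dots> = (\<integral>y. 1 / (1 + c) * exponential_density (1 + c) y \<partial>lborel)"
    using assms
    by (intro Bochner_Integration.integral_cong)
       (auto simp: exponential_density_def exp_add[symmetric] eq_divide_eq algebra_simps)
  also have "\<dots> = 1 / (1 + c)"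
    unfolding integral_mult_right_zero using tot[of "1 + c"] assms by simp
  finally show ?thesis .
qed

lemma stieltjes_subordinator:
  assumes "stieltjes K"
    and lim0: "((\<lambda>l. l * K l) \<longlongrightarrow> 0) (at_right 0)"
    and K_top: "(K \<longlongrightarrow> 0) at_top"
    and top: "filterlim (\<lambda>l. l * K l) at_top at_top"
    and "\<tau> \<ge> 0"
  shows "\<exists>\<mu>. laplace_dist \<mu> (\<lambda>l. exp (- \<tau> * l * K l))"
proof -
  obtain a b and \<sigma> :: "real measure" where ab: "a \<ge> 0" "b \<ge> 0"
    and sets: "sets \<sigma> = sets (restrict_space borel {0<..})"
    and int1: "integrable \<sigma> (\<lambda>t. 1 / (1 + t))"
    and K: "\<And>l. l > 0 \<Longrightarrow> K l = a / l + b + (\<integral>t. 1 / (l + t) \<partial>\<sigma>)"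
    using assms(1) unfolding stieltjes_def by blast
  have space: "space \<sigma> = {0<..}"
    using sets_eq_imp_space_eq[OF sets] by (simp add: space_restrict_space)
  have bm: "f \<in> borel_measurable \<sigma>" if "f \<in> borel_measurable borel" for f :: "real \<Rightarrow> real"
    using measurable_restrict_space1[OF that] measurable_cong_sets[OF sets refl] by blast
  have S_nonneg: "(\<integral>t. 1 / (l + t) \<partial>\<sigma>) \<ge> 0" if "l > 0" for l
    using that by (intro integral_nonneg_AE) (auto simp: space)
  \<comment> \<open>The remaining terms of \<open>l * K l\<close> are nonnegative, so its limit 0 at
    the origin bounds \<open>a\<close>; the limit of \<open>K\<close> at infinity bounds
    \<open>b\<close> in the same way.\<close>
  have "a \<le> 0"
  proof (rule tendsto_lowerbound[OF lim0])
    show "\<forall>\<^sub>F l in at_right 0. a \<le> l * K l"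
      using eventually_at_right_less[of 0]
    proof eventually_elim
      case (elim l)
      thus ?case using K[of l] S_nonneg[of l] ab by (simp add: distrib_left)
    qed
  qed simp
  moreover have "b \<le> 0"
  proof (rule tendsto_lowerbound[OF K_top])
    show "\<forall>\<^sub>F l in at_top. b \<le> K l"
      using eventually_gt_at_top[of 0]
    proof eventually_elim
      case (elim l)
      thus ?case using K[of l] S_nonneg[of l] ab by simp
    qed
  qed simp
  ultimately have K: "K l = (\<integral>t. 1 / (l + t) \<partial>\<sigma>)" if "l > 0" for l
    using ab K[OF that] by simp
  have int: "integrable \<sigma> (\<lambda>t. 1 / (l + t))" if "l > 0" for l
  proof (rule Bochner_Integration.integrable_bound)
    show "integrable \<sigma> (\<lambda>t. max 1 (1 / l) * (1 / (1 + t)))"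
      using int1 by (rule integrable_mult_right)
    show "(\<lambda>t. 1 / (l + t)) \<in> borel_measurable \<sigma>" by (rule bm) measurable
    have "1 / (l + t) \<le> max 1 (1 / l) * (1 / (1 + t))" if "t > 0" for t
    proof -
      have "1 + t \<le> max 1 (1 / l) * l + max 1 (1 / l) * t"
        using \<open>l > 0\<close> \<open>t > 0\<close> mult_right_mono[of "1 / l" "max 1 (1 / l)" l]
          mult_right_mono[of 1 "max 1 (1 / l)" t] by (intro add_mono) auto
      thus ?thesis using \<open>l > 0\<close> \<open>t > 0\<close> by (simp add: field_simps)
    qed
    thus "AE t in \<sigma>. norm (1 / (l + t)) \<le> norm (max 1 (1 / l) * (1 / (1 + t)))"
      using that by (auto simp: space abs_mult)
  qed
  let ?E = "density lborel (exponential_density 1)"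
  interpret E: prob_space ?E by (rule prob_space_exponential_density) simp
  \<comment> \<open>The transform of \<open>Y / t\<close>, where \<open>Y\<close> is standard exponential and \<open>t\<close> is distributed as \<open>\<sigma>\<close>
    weighted by \<open>n / (n + t)\<close> and normalised; the total mass of the weighted \<open>\<sigma>\<close> is \<open>n * K n\<close>.\<close>
  define \<psi> where "\<psi> n l = (\<integral>t. t / (t + l) * (1 / ((n + t) * K n)) \<partial>\<sigma>)" for n l
  have ex: "\<exists>\<mu>. laplace_dist \<mu> (\<psi> n)" if n: "n > 0" "K n > 0" for n
  proof -
    define P where "P = density \<sigma> (\<lambda>t. ennreal (1 / ((n + t) * K n)))"
    have [measurable]: "(\<lambda>t. 1 / ((n + t) * K n)) \<in> borel_measurable \<sigma>" by (rule bm) measurable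
    have spaceP: "space P = {0<..}" by (simp add: P_def space)
    have bmP: "f \<in> borel_measurable P" if "f \<in> borel_measurable borel" for f :: "real \<Rightarrow> real"
      using bm[OF that] by (simp add: P_def)
    have "integrable \<sigma> (\<lambda>t. 1 / (n + t) * (1 / K n))"
      using int[OF n(1)] by (rule integrable_mult_left)
    hence "(\<integral>\<^sup>+t. ennreal (1 / ((n + t) * K n)) \<partial>\<sigma>) = ennreal (\<integral>t. 1 / (n + t) * (1 / K n) \<partial>\<sigma>)"
      using n
      by (subst nn_integral_eq_integral[symmetric]) (auto simp: space)
    also have "\<dots> = ennreal (K n * (1 / K n))"
      unfolding integral_mult_left_zero K[OF n(1)] ..
    finally have "emeasure P (space P) = 1"
      using n by (simp add: P_def emeasure_density cong: nn_integral_cong)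
    then interpret P: prob_space P by (rule prob_spaceI)
    interpret PE: pair_prob_space P ?E ..
    let ?M = "P \<Otimes>\<^sub>M ?E" and ?X = "\<lambda>z. snd z / fst z"
    have [measurable]: "fst \<in> borel_measurable ?M" "snd \<in> borel_measurable ?M"
      using measurable_compose[OF measurable_fst bmP[OF measurable_ident]]
        measurable_compose[OF measurable_snd, of "\<lambda>x. x" ?E borel P] by auto
    have nn: "AE z in ?M. 0 \<le> ?X z"
    proof (rule PE.AE_pair_measure)
      show "{z \<in> space ?M. 0 \<le> ?X z} \<in> sets ?M" by measurable
      have "AE y in ?E. 0 \<le> y"
        by (auto simp: AE_density exponential_density_def ennreal_eq_0_iff not_less intro!: AE_I2)
      thus "AE x in P. AE y in ?E. 0 \<le> ?X (x, y)"
        by (auto simp: spaceP elim!: eventually_mono)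
    qed
    have "laplace_dist (distr ?M borel ?X) (\<lambda>l. \<integral>z. exp (- l * ?X z) \<partial>?M)"
      using PE.prob_space_axioms nn by (intro laplace_dist_distr) auto
    moreover have "(\<integral>z. exp (- l * ?X z) \<partial>?M) = \<psi> n l" if "l > 0" for l
    proof -
      have "AE z in ?M. norm (exp (- l * ?X z)) \<le> 1"
        using nn
      proof eventually_elim
        case (elim z)
        with that have "0 \<le> l * ?X z" by (intro mult_nonneg_nonneg) auto
        thus ?case by simp
      qed
      hence "integrable ?M (\<lambda>z. exp (- l * ?X z))"
        by (rule PE.integrable_const_bound) auto
      from PE.integral_fst'[OF this]
      have "(\<integral>z. exp (- l * ?X z) \<partial>?M) = (\<integral>t. (\<integral>y. exp (- (l / t) * y) \<partial>?E) \<partial>P)"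
        by simp
      also have "\<dots> = (\<integral>t. t / (t + l) \<partial>P)"
      proof (rule Bochner_Integration.integral_cong)
        fix t assume "t \<in> space P"
        hence "t > 0" by (simp add: spaceP)
        hence "(\<integral>y. exp (- (l / t) * y) \<partial>?E) = 1 / (1 + l / t)"
          using that by (intro laplace_exponential) auto
        also have "\<dots> = t / (t + l)" using that \<open>t > 0\<close> by (simp add: field_simps)
        finally show "(\<integral>y. exp (- (l / t) * y) \<partial>?E) = t / (t + l)" .
      qed simp
      also have "\<dots> = (\<integral>t. (1 / ((n + t) * K n)) *\<^sub>R (t / (t + l)) \<partial>\<sigma>)"
        unfolding P_def
        by (rule integral_density) (use n in \<open>auto simp: space intro!: bm\<close>)
      finally show ?thesis by (simp add: \<psi>_def mult.commute)
    qed
    ultimately show ?thesis by (blast intro: laplace_dist_cong)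
  qed
  \<comment> \<open>The compound Poisson exponent in closed form. As \<open>n\<close> tends to
    infinity, \<open>K n\<close> and \<open>l / n\<close> vanish and \<open>l * K l\<close>
    remains.\<close>
  have \<psi>: "n * K n * (1 - \<psi> n l) = l * (K l - K n) / (1 - l / n)"
    if "l > 0" "n > l" "K n > 0" for n l
  proof -
    have pos: "n > 0" using that by simp
    have i: "integrable \<sigma> (\<lambda>t. c * (1 / (x + t)))" if "x > 0" for c x
      using int[OF that] by (rule integrable_mult_right)
    have "(\<integral>t. n * (1 / (n + t)) - l * (1 / (l + t)) \<partial>\<sigma>) =
        (\<integral>t. n * (1 / (n + t)) \<partial>\<sigma>) - (\<integral>t. l * (1 / (l + t)) \<partial>\<sigma>)"
      by (rule Bochner_Integration.integral_diff[OF i[OF pos] i[OF that(1)]])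
    hence diff: "(\<integral>t. n * (1 / (n + t)) - l * (1 / (l + t)) \<partial>\<sigma>) = n * K n - l * K l"
      unfolding integral_mult_right_zero K[OF pos] K[OF that(1)] .
    have "\<psi> n l = (\<integral>t. (n * (1 / (n + t)) - l * (1 / (l + t))) * (1 / ((n - l) * K n)) \<partial>\<sigma>)"
      unfolding \<psi>_def
    proof (rule Bochner_Integration.integral_cong)
      fix t assume "t \<in> space \<sigma>"
      hence "t > 0" by (simp add: space)
      \<comment> \<open>Partial fractions: this reduces the integral defining \<psi> to the values
        of \<open>K\<close> at \<open>n\<close> and \<open>l\<close>.\<close>
      have "n * (1 / (n + t)) - l * (1 / (l + t)) = (n * (l + t) - l * (n + t)) / ((n + t) * (l + t))"
        using that \<open>t > 0\<close> by (simp add: field_simps)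
      also have "n * (l + t) - l * (n + t) = t * (n - l)" by algebra
      finally show "t / (t + l) * (1 / ((n + t) * K n)) =
          (n * (1 / (n + t)) - l * (1 / (l + t))) * (1 / ((n - l) * K n))"
        using that by (simp add: add.commute)
    qed simp
    also have "\<dots> = (n * K n - l * K l) * (1 / ((n - l) * K n))"
      unfolding integral_mult_left_zero diff by (rule refl)
    finally show ?thesis using that by (simp add: divide_simps) algebra
  qed
  \<comment> \<open>The growth of \<open>l * K l\<close> makes \<open>K\<close> positive along the
    sequence \<open>x\<close>, so that the weighted measures can be normalised.\<close>
  obtain N0 where N0: "\<And>n. n \<ge> N0 \<Longrightarrow> n * K n \<ge> 1"
    using top unfolding filterlim_at_top by (auto simp: eventually_at_top_linorder)
  define x where "x n = max N0 1 + real n" for n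
  have x: "x n > 0" "K (x n) > 0" "x n * K (x n) > 0" for n
  proof -
    show "x n > 0" by (simp add: x_def)
    have "N0 \<le> x n" unfolding x_def by linarith
    from N0[OF this] show "x n * K (x n) > 0" by simp
    with \<open>x n > 0\<close> show "K (x n) > 0" by (simp add: zero_less_mult_iff)
  qed
  have x_top: "filterlim x at_top sequentially"
    unfolding x_def by (intro filterlim_tendsto_add_at_top[OF tendsto_const] filterlim_real_sequentially)
  have "\<exists>\<mu>. laplace_dist \<mu> (\<lambda>l. exp (- (\<tau> * (x n * K (x n))) * (1 - \<psi> (x n) l)))" for n
  proof -
    obtain \<mu> where "laplace_dist \<mu> (\<psi> (x n))" using ex[OF x(1,2)] by blast
    thus ?thesis using x[of n] \<open>\<tau> \<ge> 0\<close> by (intro laplace_dist_compound_poisson) auto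
  qed
  then obtain \<mu> where \<mu>: "\<And>n. laplace_dist (\<mu> n) (\<lambda>l. exp (- (\<tau> * (x n * K (x n))) * (1 - \<psi> (x n) l)))"
    by metis
  show ?thesis
  proof (rule laplace_dist_limit[OF \<mu>])
    fix l :: real assume "l > 0"
    have inv: "(\<lambda>n. l / x n) \<longlonglongrightarrow> 0"
      using x_top by (rule real_tendsto_divide_at_top[OF tendsto_const])
    have "(\<lambda>n. exp (- \<tau> * (l * (K l - K (x n)) / (1 - l / x n)))) \<longlonglongrightarrow> exp (- \<tau> * (l * (K l - 0) / (1 - 0)))"
      by (intro tendsto_intros inv filterlim_compose[OF K_top x_top]) auto
    moreover have "\<forall>\<^sub>F n in sequentially. exp (- \<tau> * (l * (K l - K (x n)) / (1 - l / x n))) =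
        exp (- (\<tau> * (x n * K (x n))) * (1 - \<psi> (x n) l))"
      using x_top[unfolded filterlim_at_top_dense, rule_format, of l]
    proof eventually_elim
      case (elim n)
      show ?case using \<psi>[OF \<open>l > 0\<close> elim x(2)] by (simp add: mult.assoc)
    qed
    ultimately have "(\<lambda>n. exp (- (\<tau> * (x n * K (x n))) * (1 - \<psi> (x n) l))) \<longlonglongrightarrow>
        exp (- \<tau> * (l * (K l - 0) / (1 - 0)))"
      by (rule Lim_transform_eventually)
    thus "(\<lambda>n. exp (- (\<tau> * (x n * K (x n))) * (1 - \<psi> (x n) l))) \<longlonglongrightarrow> exp (- \<tau> * l * K l)"
      by (simp add: mult.assoc)
  next
    have "((\<lambda>l. exp (- \<tau> * (l * K l))) \<longlongrightarrow> exp (- \<tau> * 0)) (at_right 0)"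
      by (intro tendsto_intros lim0)
    thus "((\<lambda>l. exp (- \<tau> * l * K l)) \<longlongrightarrow> 1) (at_right 0)" by (simp add: mult.assoc)
  qed
qed

text \<open>Restriction to the half-line loses no mass, which gives a solution of the defining
  description. Any other solution, pushed forward to the Borel line, has the same transform and is
  therefore \<mu> itself.\<close>

lemma subordination_measure_eq:
  assumes \<mu>: "laplace_dist \<mu> (\<lambda>l. exp (- \<tau> * l * laplace k l))"
  shows "subordination_measure k \<tau> = restrict_space \<mu> {0..}"
  unfolding subordination_measure_def
proof (rule the_equality, intro conjI allI impI)
  interpret real_distribution \<mu> using \<mu> by (simp add: laplace_dist_def)
  have nn: "AE x in \<mu>. 0 \<le> x" using \<mu> by (simp add: laplace_dist_def)
  have "emeasure \<mu> {0..} = emeasure \<mu> (space \<mu>)"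
    by (rule emeasure_eq_AE) (use nn in auto)
  thus "prob_space (restrict_space \<mu> {0..})"
    by (intro prob_space_restrict_space) (auto simp: emeasure_space_1[simplified])
  show "sets (restrict_space \<mu> {0..}) = sets (restrict_space borel {0..})"
    by (rule sets_restrict_space_cong) simp
  fix l :: real assume "l > 0"
  have "(\<integral>s. exp (- l * s) \<partial>restrict_space \<mu> {0..}) = (\<integral>s. indicator {0..} s *\<^sub>R exp (- l * s) \<partial>\<mu>)"
    by (rule integral_restrict_space) simp
  also have "\<dots> = (\<integral>s. exp (- l * s) \<partial>\<mu>)"
    by (rule integral_cong_AE) (use nn in \<open>auto elim!: eventually_mono\<close>)
  finally show "exp (- \<tau> * l * laplace k l) = (\<integral>s. exp (- l * s) \<partial>restrict_space \<mu> {0..})"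
    using \<mu> \<open>l > 0\<close> by (simp add: laplace_dist_def)
next
  fix \<nu> :: "real measure"
  assume \<nu>: "prob_space \<nu> \<and> sets \<nu> = sets (restrict_space borel {0..}) \<and>
    (\<forall>l>0. exp (- \<tau> * l * laplace k l) = (\<integral>s. exp (- l * s) \<partial>\<nu>))"
  hence sets: "sets \<nu> = sets (restrict_space borel {0..})" by simp
  have space: "space \<nu> = {0..}"
    using sets_eq_imp_space_eq[OF sets] by (simp add: space_restrict_space)
  have id: "(\<lambda>x. x) \<in> borel_measurable \<nu>"
    by (subst measurable_cong_sets[OF sets refl]) (rule measurable_restrict_space1, simp)
  have "laplace_dist (distr \<nu> borel (\<lambda>x. x)) (\<lambda>l. \<integral>x. exp (- l * x) \<partial>\<nu>)"
    using \<nu> id by (intro laplace_dist_distr) (auto simp: space)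
  hence "laplace_dist (distr \<nu> borel (\<lambda>x. x)) (\<lambda>l. exp (- \<tau> * l * laplace k l))"
    by (rule laplace_dist_cong) (use \<nu> in auto)
  hence eq: "\<mu> = distr \<nu> borel (\<lambda>x. x)" using \<mu> by (intro laplace_dist_unique)
  show "\<nu> = restrict_space \<mu> {0..}"
  proof (rule measure_eqI)
    show "sets \<nu> = sets (restrict_space \<mu> {0..})"
      unfolding sets eq by (rule sets_restrict_space_cong) simp
    fix A assume "A \<in> sets \<nu>"
    hence A: "A \<subseteq> {0..}" "A \<in> sets borel" by (auto simp: sets sets_restrict_space_iff)
    have "emeasure (restrict_space \<mu> {0..}) A = emeasure \<mu> A"
      using A by (intro emeasure_restrict_space) (auto simp: eq)
    also have "\<dots> = emeasure \<nu> A"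
      unfolding eq using A id by (subst emeasure_distr) (auto simp: space intro!: arg_cong[where f = "emeasure \<nu>"])
    finally show "emeasure \<nu> A = emeasure (restrict_space \<mu> {0..}) A" ..
  qed
qed

section \<open>The primitive of the convolution\<close>

text \<open>The weight splits as \<open>exp (- l * t) = exp (- l * s) * exp (- l * (t - s))\<close>.
  By translation invariance the inner integral of the norm is a constant times
  \<open>exp (- l * s)\<close>, which is \<mu>-integrable.\<close>

lemma convolution_exp_weight_integrable:
  fixes q :: "real \<Rightarrow> real"
  assumes \<mu>: "laplace_dist \<mu> \<phi>" and "l > 0" and [measurable]: "q \<in> borel_measurable borel"
    and q: "integrable lborel (\<lambda>x. exp (- l * x) * q x)"
  shows "integrable (\<mu> \<Otimes>\<^sub>M lborel) (\<lambda>(s, t). exp (- l * t) * q (t - s))"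
proof -
  interpret real_distribution \<mu> using \<mu> by (simp add: laplace_dist_def)
  interpret pair_sigma_finite \<mu> lborel ..
  have *: "exp (- l * t) * q (t - s) = exp (- l * s) * (exp (- l * (- s + 1 * t)) * q (- s + 1 * t))" for s t
    by (simp add: exp_add[symmetric] algebra_simps)
  have norm: "(\<integral>t. norm (exp (- l * t) * q (t - s)) \<partial>lborel) =
      exp (- l * s) * (\<integral>t. norm (exp (- l * t) * q t) \<partial>lborel)" for s
    unfolding * norm_mult[of "exp (- l * s)"] integral_mult_right_zero
    by (subst (2) lborel_integral_real_affine[of 1 _ "- s"]) simp_all
  show ?thesis
  proof (rule Fubini_integrable)
    show "(\<lambda>(s, t). exp (- l * t) * q (t - s)) \<in> borel_measurable (\<mu> \<Otimes>\<^sub>M lborel)"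
      by measurable
    show "integrable \<mu> (\<lambda>s. \<integral>t. norm (case (s, t) of (s, t) \<Rightarrow> exp (- l * t) * q (t - s)) \<partial>lborel)"
      unfolding prod.case norm using integrable_exp_laplace_dist[OF \<mu>, of l] \<open>l > 0\<close>
      by (intro integrable_mult_left) auto
    have "integrable lborel (\<lambda>t. exp (- l * t) * q (t - s))" for s
      unfolding * by (intro integrable_mult_right lborel_integrable_real_affine[OF q]) simp
    thus "AE s in \<mu>. integrable lborel (\<lambda>t. case (s, t) of (s, t) \<Rightarrow> exp (- l * t) * q (t - s))"
      by simp
  qed
qed

text \<open>Replaces the measure on the half-line and the domain \<open>{0..<t}\<close> by a cut-off
  kernel on the whole line. The cut-off is strict because \<open>s < t\<close> means
  \<open>t - s > 0\<close>.\<close>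

lemma G_eq_convolution:
  assumes \<mu>: "laplace_dist \<mu> (\<lambda>l. exp (- \<tau> * l * laplace k l))"
    and [measurable]: "(\<lambda>x. indicator {0<..} x * k x) \<in> borel_measurable borel"
  shows "G k t \<tau> = (\<integral>s. indicator {0<..} (t - s) * k (t - s) \<partial>\<mu>)"
proof -
  interpret real_distribution \<mu> using \<mu> by (simp add: laplace_dist_def)
  have m: "(\<lambda>s. indicator {0<..} (t - s) * k (t - s)) \<in> borel_measurable \<mu>"
    using measurable_compose[of "\<lambda>s. t - s" \<mu> borel, OF _ assms(2)] by simp
  have "G k t \<tau> = (\<integral>s. indicator {0..} s *\<^sub>R (indicator {0..<t} s *\<^sub>R k (t - s)) \<partial>\<mu>)"
    unfolding G_def subordination_measure_eq[OF \<mu>] set_lebesgue_integral_def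
    by (rule integral_restrict_space) simp
  also have "\<dots> = (\<integral>s. indicator {0..} s *\<^sub>R (indicator {0<..} (t - s) * k (t - s)) \<partial>\<mu>)"
    by (rule Bochner_Integration.integral_cong) (auto simp: indicator_def)
  also have "\<dots> = (\<integral>s. indicator {0<..} (t - s) * k (t - s) \<partial>\<mu>)"
  proof (rule integral_cong_AE)
    show "AE s in \<mu>. indicator {0..} s *\<^sub>R (indicator {0<..} (t - s) * k (t - s)) =
        indicator {0<..} (t - s) * k (t - s)"
      using \<mu> by (auto simp: laplace_dist_def elim!: eventually_mono)
  qed (use m in \<open>auto intro!: borel_measurable_scaleR\<close>)
  finally show ?thesis .
qed

text \<open>Both claims rest on the joint integrability of the weighted convolution: one integrates
  out \<open>s\<close>, the other exchanges the order of integration.\<close>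

lemma
  assumes \<mu>: "laplace_dist \<mu> (\<lambda>l. exp (- \<tau> * l * laplace k l))"
    and k: "\<And>l. l > 0 \<Longrightarrow> set_integrable lborel {0..} (\<lambda>t. exp (- l * t) * k t)"
  shows set_integrable_exp_G:
      "\<And>l. l > 0 \<Longrightarrow> set_integrable lborel {0..} (\<lambda>t. exp (- l * t) * G k t \<tau>)"
    and set_integral_G:
      "(LBINT t:{0..T}. G k t \<tau>) = (\<integral>s. (LBINT t:{0..T - s}. k t) \<partial>\<mu>)"
proof -
  interpret real_distribution \<mu> using \<mu> by (simp add: laplace_dist_def)
  interpret P: pair_sigma_finite \<mu> lborel ..
  define q where "q = (\<lambda>x. indicator {0<..} x * k x)"
  have q: "integrable lborel (\<lambda>x. exp (- l * x) * q x)" if "l > 0" for l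
  proof -
    have "set_integrable lborel {0<..} (\<lambda>t. exp (- l * t) * k t)"
      by (rule set_integrable_subset[OF k[OF that]]) auto
    thus ?thesis by (simp add: set_integrable_def q_def mult_ac)
  qed
  \<comment> \<open>Measurability of \<open>q\<close> is recovered from the integrable function with
    weight \<open>l = 1\<close> by dividing the weight out.\<close>
  have "(\<lambda>x. exp (1 * x) * (exp (- 1 * x) * q x)) \<in> borel_measurable borel"
    by (rule borel_measurable_times) (use borel_measurable_integrable[OF q[of 1]] in simp_all)
  also have "(\<lambda>x. exp (1 * x) * (exp (- 1 * x) * q x)) = q"
    by (simp add: fun_eq_iff exp_minus)
  finally have [measurable]: "q \<in> borel_measurable borel" .
  note G = G_eq_convolution[OF \<mu>, folded q_def, OF \<open>q \<in> _\<close>]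
  have int: "integrable (\<mu> \<Otimes>\<^sub>M lborel) (\<lambda>(s, t). exp (- l * t) * q (t - s))" if "l > 0" for l
    using \<mu> that _ q[OF that] by (rule convolution_exp_weight_integrable) measurable
  show "set_integrable lborel {0..} (\<lambda>t. exp (- l * t) * G k t \<tau>)" if "l > 0" for l
  proof -
    have "integrable lborel (\<lambda>t. exp (- l * t) * G k t \<tau>)"
      using P.integrable_snd[OF int[OF that]] by (simp add: G q_def)
    thus ?thesis unfolding set_integrable_def by (intro integrable_mult_indicator) auto
  qed
  \<comment> \<open>Passing from \<open>k\<close> to \<open>q\<close> alters the integrand only at
    the null point 0 and makes measurability in \<open>u\<close> evident.\<close>
  have primitive: "(LBINT t:{0..u}. k t) = (\<integral>x. indicator {0..} (u - x) * q x \<partial>lborel)" for u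
    unfolding set_lebesgue_integral_def
  proof (rule Bochner_Integration.integral_cong_AE)
    have "(\<lambda>x. indicator {0..u} x *\<^sub>R k x) = (\<lambda>x. indicator {0..u} x * (q x + indicator {0} x * k 0))"
      by (auto simp: q_def indicator_def)
    also have "\<dots> \<in> borel_measurable lborel" by measurable
    finally show "(\<lambda>x. indicator {0..u} x *\<^sub>R k x) \<in> borel_measurable lborel" .
    show "(\<lambda>x. indicator {0..} (u - x) * q x) \<in> borel_measurable lborel" by measurable
    show "AE x in lborel. indicator {0..u} x *\<^sub>R k x = indicator {0..} (u - x) * q x"
      using AE_lborel_singleton[of "0::real"]
      by eventually_elim (auto simp: q_def indicator_def)
  qed
  have "integrable (\<mu> \<Otimes>\<^sub>M lborel) (\<lambda>(s, t). indicator {0..T} t * q (t - s))"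
  proof (rule Bochner_Integration.integrable_bound)
    \<comment> \<open>For \<open>t \<le> T\<close> the factor \<open>exp T * exp (- t)\<close> is at
      least one, so the weighted integrand with \<open>l = 1\<close> dominates the truncated
      one.\<close>
    show "integrable (\<mu> \<Otimes>\<^sub>M lborel) (\<lambda>z. exp T * (case z of (s, t) \<Rightarrow> exp (- 1 * t) * q (t - s)))"
      using int[of 1] by (intro integrable_mult_right) auto
    show "(\<lambda>(s, t). indicator {0..T} t * q (t - s)) \<in> borel_measurable (\<mu> \<Otimes>\<^sub>M lborel)"
      by measurable
    have "1 \<le> exp T * exp (- 1 * t)" if "t \<le> T" for t :: real
      using that by (simp add: exp_add[symmetric])
    hence "\<bar>q (t - s)\<bar> \<le> exp T * exp (- 1 * t) * \<bar>q (t - s)\<bar>" if "t \<le> T" for s t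
      using that mult_right_mono[of 1 "exp T * exp (- 1 * t)" "\<bar>q (t - s)\<bar>"] by simp
    thus "AE z in \<mu> \<Otimes>\<^sub>M lborel. norm (case z of (s, t) \<Rightarrow> indicator {0..T} t * q (t - s)) \<le>
        norm (exp T * (case z of (s, t) \<Rightarrow> exp (- 1 * t) * q (t - s)))"
      by (auto simp: indicator_def abs_mult mult.assoc intro!: AE_I2)
  qed
  from P.Fubini_integral[OF this]
  have "(LBINT t:{0..T}. G k t \<tau>) = (\<integral>s. (\<integral>t. indicator {0..T} t * q (t - s) \<partial>lborel) \<partial>\<mu>)"
    by (simp add: set_lebesgue_integral_def G q_def)
  also have "\<dots> = (\<integral>s. (LBINT t:{0..T - s}. k t) \<partial>\<mu>)"
  proof (rule Bochner_Integration.integral_cong_AE)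
    \<comment> \<open>After the substitution \<open>t = s + x\<close>, only \<open>x > 0\<close>
      contributes; since \<open>s \<ge> 0\<close>, the lower bound \<open>0 \<le> s + x\<close> then
      holds by itself. For \<open>s > T\<close> both sides are 0.\<close>
    have inner: "(\<integral>t. indicator {0..T} t * q (t - s) \<partial>lborel) = (LBINT t:{0..T - s}. k t)" if "s \<ge> 0" for s
    proof -
      have "(\<integral>t. indicator {0..T} t * q (t - s) \<partial>lborel) = (\<integral>x. indicator {0..T} (s + x) * q x \<partial>lborel)"
        by (subst lborel_integral_real_affine[of 1 _ s]) simp_all
      also have "\<dots> = (\<integral>x. indicator {0..} (T - s - x) * q x \<partial>lborel)"
        using that by (intro Bochner_Integration.integral_cong) (auto simp: indicator_def q_def)
      also have "\<dots> = (LBINT t:{0..T - s}. k t)"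
        by (simp add: primitive)
      finally show ?thesis .
    qed
    thus "AE s in \<mu>. (\<integral>t. indicator {0..T} t * q (t - s) \<partial>lborel) = (LBINT t:{0..T - s}. k t)"
      using \<mu> by (auto simp: laplace_dist_def elim!: eventually_mono)
    show "(\<lambda>s. \<integral>t. indicator {0..T} t * q (t - s) \<partial>lborel) \<in> borel_measurable \<mu>"
      by measurable
    show "(\<lambda>s. LBINT t:{0..T - s}. k t) \<in> borel_measurable \<mu>"
      unfolding primitive by measurable
  qed
  finally show "(LBINT t:{0..T}. G k t \<tau>) = (\<integral>s. (LBINT t:{0..T - s}. k t) \<partial>\<mu>)" .
qed

section \<open>Monotonicity of the primitive and the conclusion\<close>

lemma
  fixes k :: "real \<Rightarrow> real"
  assumes k: "\<And>T. T > 0 \<Longrightarrow> set_integrable lborel {0..T} k"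
    and nn: "AE t in lborel. t \<ge> 0 \<longrightarrow> k t \<ge> 0"
  shows set_integral_Icc_mono: "x \<le> y \<Longrightarrow> (LBINT t:{0..x}. k t) \<le> (LBINT t:{0..y}. k t)"
    and set_integral_Icc_nonneg: "0 \<le> (LBINT t:{0..x}. k t)"
proof -
  \<comment> \<open>Local integrability is given for positive endpoints only, hence
    \<open>max 1 x\<close>; for negative \<open>x\<close> the interval is empty.\<close>
  have int: "integrable lborel (\<lambda>t. indicator {0..x} t *\<^sub>R k t)" for x
    using set_integrable_subset[OF k[of "max 1 x"], of "{0..x}"] unfolding set_integrable_def by simp
  show "(LBINT t:{0..x}. k t) \<le> (LBINT t:{0..y}. k t)" if "x \<le> y"
    unfolding set_lebesgue_integral_def
    by (rule integral_mono_AE[OF int int]) (use nn in eventually_elim, use that in \<open>auto simp: indicator_def\<close>)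
  show "0 \<le> (LBINT t:{0..x}. k t)"
    unfolding set_lebesgue_integral_def
    by (rule integral_nonneg_AE) (use nn in eventually_elim, auto simp: indicator_def)
qed

theorem theorem3p3:
  fixes k :: "real \<Rightarrow> real"
  assumes "admissible_kernel k"
  shows "(\<forall>\<tau>\<ge>0.
            (\<forall>l>0. set_integrable lborel {0..} (\<lambda>t. exp (- l * t) * G k t \<tau>)) \<and>
            ((\<lambda>t. (LBINT s:{0..t}. G k s \<tau>) * inverse (LBINT s:{0..t}. k s)) \<longlongrightarrow> 1) at_top \<and>
            (\<lambda>t. 1 / t * (LBINT s:{0..t}. G k s \<tau>))
              \<sim>[at_top] (\<lambda>t. 1 / t * (LBINT s:{0..t}. k s))) \<and>
         (\<forall>t>0. bdd_above ((\<lambda>\<tau>. 1 / t * (LBINT s:{0..t}. G k s \<tau>)) ` {0..}))"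
proof -
  \<comment> \<open>On negative arguments \<kappa> is 0, the integral over an empty interval, so
    \<open>\<kappa> (t - s)\<close> is harmless for \<open>s > t\<close>.\<close>
  define \<kappa> where "\<kappa> x = (LBINT s:{0..x}. k s)" for x
  have loc: "\<And>T. T > 0 \<Longrightarrow> set_integrable lborel {0..T} k"
    and nn: "AE t in lborel. t \<ge> 0 \<longrightarrow> k t \<ge> 0"
    and lap: "\<And>l. l > 0 \<Longrightarrow> set_integrable lborel {0..} (\<lambda>t. exp (- l * t) * k t)"
    and sub: "stieltjes (laplace k)" "((\<lambda>l. l * laplace k l) \<longlongrightarrow> 0) (at_right 0)"
      "(laplace k \<longlongrightarrow> 0) at_top" "filterlim (\<lambda>l. l * laplace k l) at_top at_top"
    and ratio: "((\<lambda>(t, r). \<kappa> t * inverse (\<kappa> r)) \<longlongrightarrow> 1)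
        (inf (at_top \<times>\<^sub>F at_top) (filtercomap (\<lambda>(t, r). t / r) (nhds 1)))"
    using assms unfolding admissible_kernel_def \<kappa>_def by blast+
  have mono: "\<kappa> x \<le> \<kappa> y" if "x \<le> y" for x y
    unfolding \<kappa>_def using loc nn that by (rule set_integral_Icc_mono)
  have nonneg: "0 \<le> \<kappa> x" for x
    unfolding \<kappa>_def using loc nn by (rule set_integral_Icc_nonneg)
  have [measurable]: "\<kappa> \<in> borel_measurable borel"
    by (intro borel_measurable_mono monoI mono)
  have shift: "((\<lambda>t. \<kappa> (t - s) * inverse (\<kappa> t)) \<longlongrightarrow> 1) at_top" for s
  proof -
    have "((\<lambda>t. (t - s) / t) \<longlongrightarrow> 1) at_top" by real_asymp
    moreover have "filterlim (\<lambda>t. t - s) at_top at_top" by real_asymp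
    \<comment> \<open>The pair \<open>(t - s, t)\<close> for fixed \<open>s\<close> is a path
      allowed by the last admissibility clause: both entries tend to infinity and their quotient to
      one.\<close>
    ultimately have "filterlim (\<lambda>t. (t - s, t))
        (inf (at_top \<times>\<^sub>F at_top) (filtercomap (\<lambda>(t, r). t / r) (nhds 1))) at_top"
      by (intro filterlim_inf[THEN iffD2] conjI filterlim_Pair)
         (auto simp: filterlim_filtercomap_iff o_def intro: filterlim_ident)
    from filterlim_compose[OF ratio this] show ?thesis by simp
  qed
  have main: "(\<forall>l>0. set_integrable lborel {0..} (\<lambda>t. exp (- l * t) * G k t \<tau>)) \<and>
      ((\<lambda>t. (LBINT s:{0..t}. G k s \<tau>) * inverse (\<kappa> t)) \<longlongrightarrow> 1) at_top \<and>
      (\<forall>t. (LBINT s:{0..t}. G k s \<tau>) \<le> \<kappa> t)" if \<tau>: "\<tau> \<ge> 0" for \<tau>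
  proof -
    obtain \<mu> where \<mu>: "laplace_dist \<mu> (\<lambda>l. exp (- \<tau> * l * laplace k l))"
      using stieltjes_subordinator[OF sub \<tau>] by blast
    interpret real_distribution \<mu> using \<mu> by (simp add: laplace_dist_def)
    have pos: "AE s in \<mu>. 0 \<le> s" using \<mu> by (simp add: laplace_dist_def)
    have G: "(LBINT s:{0..t}. G k s \<tau>) = (\<integral>s. \<kappa> (t - s) \<partial>\<mu>)" for t
      unfolding \<kappa>_def using \<mu> lap by (rule set_integral_G)
    have le: "AE s in \<mu>. \<kappa> (t - s) \<le> \<kappa> t" for t
      using pos by eventually_elim (auto intro: mono)
    have "((\<lambda>t. \<integral>s. \<kappa> (t - s) * inverse (\<kappa> t) \<partial>\<mu>) \<longlongrightarrow> (\<integral>s. 1 \<partial>\<mu>)) at_top"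
    proof (rule integral_dominated_convergence_at_top[where w = "\<lambda>_. 1"])
      show "\<forall>\<^sub>F t in at_top. AE s in \<mu>. norm (\<kappa> (t - s) * inverse (\<kappa> t)) \<le> 1"
      proof (rule always_eventually, rule allI)
        fix t show "AE s in \<mu>. norm (\<kappa> (t - s) * inverse (\<kappa> t)) \<le> 1"
          using le[of t]
        proof eventually_elim
          case (elim s)
          \<comment> \<open>If \<open>\<kappa> t = 0\<close>, its inverse is 0 by convention and the
            bound is trivial.\<close>
          thus ?case using nonneg[of t] nonneg[of "t - s"]
            by (cases "\<kappa> t = 0") (auto simp: field_simps)
        qed
      qed
    qed (use shift in auto)
    hence "((\<lambda>t. (LBINT s:{0..t}. G k s \<tau>) * inverse (\<kappa> t)) \<longlongrightarrow> 1) at_top"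
      unfolding integral_mult_left_zero G using prob_space by simp
    moreover have "(LBINT s:{0..t}. G k s \<tau>) \<le> \<kappa> t" for t
    proof -
      have "(\<integral>s. \<kappa> (t - s) \<partial>\<mu>) \<le> (\<integral>s. \<kappa> t \<partial>\<mu>)"
      proof (rule integral_mono_AE)
        show "integrable \<mu> (\<lambda>s. \<kappa> (t - s))"
          by (rule integrable_const_bound[where B = "\<kappa> t"]) (use le nonneg in auto)
      qed (use le in auto)
      thus ?thesis unfolding G using prob_space by simp
    qed
    ultimately show ?thesis using set_integrable_exp_G[OF \<mu> lap] by blast
  qed
  have "(\<lambda>t. 1 / t * (LBINT s:{0..t}. G k s \<tau>)) \<sim>[at_top] (\<lambda>t. 1 / t * \<kappa> t)" if "\<tau> \<ge> 0" for \<tau>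
  proof (rule asymp_equivI')
    from main[OF that] have "((\<lambda>t. (LBINT s:{0..t}. G k s \<tau>) * inverse (\<kappa> t)) \<longlongrightarrow> 1) at_top"
      by (elim conjE)
    moreover have "\<forall>\<^sub>F t in at_top. (LBINT s:{0..t}. G k s \<tau>) * inverse (\<kappa> t) =
        (1 / t * (LBINT s:{0..t}. G k s \<tau>)) / (1 / t * \<kappa> t)"
      using eventually_gt_at_top[of 0] by eventually_elim (auto simp: divide_inverse)
    ultimately show "((\<lambda>t. (1 / t * (LBINT s:{0..t}. G k s \<tau>)) / (1 / t * \<kappa> t)) \<longlongrightarrow> 1) at_top"
      by (rule Lim_transform_eventually)
  qed
  \<comment> \<open>The bound \<open>\<kappa> t\<close> for the primitive is the same for every
    \<tau>.\<close>
  moreover have "bdd_above ((\<lambda>\<tau>. 1 / t * (LBINT s:{0..t}. G k s \<tau>)) ` {0..})" if "t > 0" for t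
    using main that by (intro bdd_aboveI2[where M = "1 / t * \<kappa> t"] mult_left_mono) auto
  ultimately show ?thesis using main unfolding \<kappa>_def by blast
qed

end
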